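(* Let $s\geq 2$ and $n\geq 2s$ be integers with $\gcd(n,s)=1$. The circulant graph $\mathrm{circ}(n;\pm1,\pm s)$ is $2$-spanning cyclable if and only if $n\geq 6$.
   Context: $\mathrm{circ}(n;\pm1,\pm s)$ is the Cayley graph on $\mathbb{Z}/n\mathbb{Z}$ with connection set $\{\pm1,\pm s\}$: vertices $u_0,\dots,u_{n-1}$ (indices mod $n$), with $u_i$ adjacent to $u_{i\pm1}$ and $u_{i\pm s}$. A 2-factor of a graph is a spanning subgraph in which every vertex has valency 2; it separates a set $A$ of $k$ vertices if it consists of exactly $k$ cycles and $A$ meets the vertex set of each cycle in exactly one vertex. A graph $X$ is $k$-spanning cyclable if for every $A\subseteq V(X)$ with $|A|=k$ there is a 2-factor of $X$ separating $A$. *)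

theory Defs
  imports Complex_Main
begin

text \<open>
  A (simple) graph is a pair of a vertex set and a set of edges, where an edge is the set of its
  two end vertices.
\<close>

type_synonym 'a graph = "'a set \<times> 'a set set"

abbreviation verts :: "'a graph \<Rightarrow> 'a set" where "verts \<equiv> fst"
abbreviation edges :: "'a graph \<Rightarrow> 'a set set" where "edges \<equiv> snd"

definition valency :: "'a graph \<Rightarrow> 'a \<Rightarrow> nat" where
  "valency X v = card {e \<in> edges X. v \<in> e}"

definition spanning_subgraph :: "'a graph \<Rightarrow> 'a graph \<Rightarrow> bool" where
  "spanning_subgraph F X \<longleftrightarrow> verts F = verts X \<and> edges F \<subseteq> edges X"

definition two_factor :: "'a graph \<Rightarrow> 'a graph \<Rightarrow> bool" where
  "two_factor F X \<longleftrightarrow> spanning_subgraph F X \<and> (\<forall>v \<in> verts F. valency F v = 2)"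

definition cycle_of :: "'a list \<Rightarrow> 'a graph" where
  "cycle_of xs = (set xs, {{xs ! i, xs ! (Suc i mod length xs)} | i. i < length xs})"

definition is_cycle :: "'a graph \<Rightarrow> bool" where
  "is_cycle C \<longleftrightarrow> (\<exists>xs. distinct xs \<and> 3 \<le> length xs \<and> C = cycle_of xs)"

text \<open>
  \<open>consists_of F \<C>\<close>: the graph \<open>F\<close> is the vertex-disjoint union of the cycles in \<open>\<C>\<close>.  For a
  2-factor of a finite graph there is exactly one such \<open>\<C>\<close>, namely its set of connected components.
\<close>

definition consists_of :: "'a graph \<Rightarrow> 'a graph set \<Rightarrow> bool" where
  "consists_of F \<C> \<longleftrightarrow>
     (\<forall>C \<in> \<C>. is_cycle C) \<and>
     (\<forall>C \<in> \<C>. \<forall>D \<in> \<C>. C \<noteq> D \<longrightarrow> verts C \<inter> verts D = {}) \<and>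
     verts F = (\<Union>C \<in> \<C>. verts C) \<and> edges F = (\<Union>C \<in> \<C>. edges C)"

definition separates :: "'a graph \<Rightarrow> 'a set \<Rightarrow> bool" where
  "separates F A \<longleftrightarrow>
     (\<exists>\<C>. consists_of F \<C> \<and> finite \<C> \<and> card \<C> = card A \<and>
          (\<forall>C \<in> \<C>. card (A \<inter> verts C) = 1))"

definition spanning_cyclable :: "nat \<Rightarrow> 'a graph \<Rightarrow> bool" where
  "spanning_cyclable k X \<longleftrightarrow>
     (\<forall>A. A \<subseteq> verts X \<and> finite A \<and> card A = k \<longrightarrow> (\<exists>F. two_factor F X \<and> separates F A))"

text \<open>
  The Cayley graph on the integers modulo \<open>n\<close>, with each residue class represented by its least
  nonnegative element.  The connection set \<open>S\<close> is given by representatives, and is assumed to be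
  closed under negation modulo \<open>n\<close> and to contain no multiple of \<open>n\<close>.
\<close>

definition cayley_Zn :: "int \<Rightarrow> int set \<Rightarrow> int graph" where
  "cayley_Zn n S = ({0..<n}, {{i, (i + c) mod n} | i c. i \<in> {0..<n} \<and> c \<in> S})"

definition circ :: "int \<Rightarrow> int \<Rightarrow> int graph" where
  "circ n s = cayley_Zn n {1, - 1, s, - s}"

text \<open>In the parameter range of interest \<open>circ n s\<close> has no loops.\<close>

lemma circ_edge_card:
  assumes "2 \<le> s" "2 * s \<le> n" "e \<in> edges (circ n s)"
  shows "e \<subseteq> verts (circ n s)" "card e = 2"
proof -
  obtain i c where i: "0 \<le> i" "i < n" and c: "c \<in> {1, - 1, s, - s}"
    and e: "e = {i, (i + c) mod n}"
    using assms(3) by (auto simp: circ_def cayley_Zn_def)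
  show "e \<subseteq> verts (circ n s)"
    using i e by (auto simp: circ_def cayley_Zn_def)
  have "(i + c) mod n \<noteq> i"
  proof
    assume "(i + c) mod n = i"
    then have "(i + c) mod n = i mod n" using i by simp
    then have "n dvd c" by (simp add: mod_eq_dvd_iff)
    moreover have "c \<noteq> 0" "\<bar>c\<bar> < n" using c assms(1,2) by auto
    ultimately show False using zdvd_not_zless[of "\<bar>c\<bar>" n] by simp
  qed
  then show "card e = 2" using e by auto
qed

end

theory Submission
  imports Defs
begin

text \<open>
  The 4-cycle on \<open>V = {0, 1, s + 1, s}\<close> has a Hamiltonian complement: for \<open>s \<ge> 3\<close> it is traversed as
  \<open>2, \<dots>, s - 1, n - 1, n - 2, \<dots>, s + 2\<close>, where both jumps have length \<open>s\<close> modulo \<open>n\<close>, and for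
  \<open>s = 2\<close> one goes up through the even vertices and down through the odd ones.  Since \<open>V\<close> is not
  invariant under any nontrivial translation, for every pair \<open>u \<noteq> v\<close> some translate of this
  2-factor separates \<open>u\<close> from \<open>v\<close>.  Conversely, two disjoint cycles need at least six vertices.
\<close>

section \<open>Cycles given by lists, and 2-factors made of two of them\<close>

lemma Suc_mod_less: "i < n \<Longrightarrow> Suc i mod n < n"
  by (rule mod_less_divisor) linarith

text \<open>The edges at \<open>xs ! j\<close> are those to its cyclic predecessor and successor;
  length at least 3 makes these two neighbours different.\<close>

lemma valency_cycle_of:
  assumes "distinct xs" "3 \<le> length xs" "v \<in> set xs"
  shows "card {e \<in> edges (cycle_of xs). v \<in> e} = 2"
proof -
  let ?n = "length xs"
  obtain j where j: "j < ?n" "v = xs ! j"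
    using assms(3) by (auto simp: in_set_conv_nth)
  \<comment> \<open>Index of the cyclic predecessor; the wrap-around is a separate case because
    \<open>0 - 1 = 0\<close> on \<open>nat\<close>.\<close>
  define p where "p = (if j = 0 then ?n - 1 else j - 1)"
  define q where "q = Suc j mod ?n"
  have p: "p < ?n" "Suc p mod ?n = j"
    using j assms(2) by (auto simp: p_def)
  have q: "q < ?n" "q \<noteq> p"
    using j assms(2) by (auto simp: q_def p_def mod_Suc)
  have succ: "i = p" if "i < ?n" "Suc i mod ?n = j" for i
    using that j assms(2) by (auto simp: p_def mod_Suc split: if_splits)
  have "{e \<in> edges (cycle_of xs). v \<in> e} = {{v, xs ! q}, {xs ! p, v}}"
  proof (intro equalityI subsetI)
    fix e assume "e \<in> {e \<in> edges (cycle_of xs). v \<in> e}"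
    then obtain i where i: "i < ?n" "e = {xs ! i, xs ! (Suc i mod ?n)}"
      and v: "xs ! j = xs ! i \<or> xs ! j = xs ! (Suc i mod ?n)"
      using j by (auto simp: cycle_of_def)
    have "Suc i mod ?n < ?n"
      using i(1) by (rule Suc_mod_less)
    then have "j = i \<or> j = Suc i mod ?n"
      using v i j assms(1) by (simp add: nth_eq_iff_index_eq)
    then show "e \<in> {{v, xs ! q}, {xs ! p, v}}"
      using i j succ[of i] by (auto simp: q_def)
  next
    fix e assume "e \<in> {{v, xs ! q}, {xs ! p, v}}"
    then show "e \<in> {e \<in> edges (cycle_of xs). v \<in> e}"
      using j p by (auto simp: cycle_of_def q_def)
  qed
  moreover have "xs ! q \<noteq> xs ! p"
    using p q assms(1) by (simp add: nth_eq_iff_index_eq)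
  then have "{v, xs ! q} \<noteq> {xs ! p, v}"
    by (auto simp: doubleton_eq_iff)
  ultimately show ?thesis
    by simp
qed

text \<open>Separates the closing edge from the consecutive ones, so that a cycle can be assembled
  from pieces by the rules for \<open>successively\<close> on \<open>@\<close>, \<open>map\<close>
  and \<open>rev\<close>.\<close>

lemma edges_cycle_of_subset:
  assumes "xs \<noteq> []" "successively (\<lambda>x y. {x, y} \<in> E) xs" "{last xs, hd xs} \<in> E"
  shows "edges (cycle_of xs) \<subseteq> E"
proof -
  have "{xs ! i, xs ! (Suc i mod length xs)} \<in> E" if "i < length xs" for i
  proof (cases "Suc i = length xs")
    case True
    then have "i = length xs - 1"
      by simp
    then show ?thesis
      using True assms by (simp add: last_conv_nth hd_conv_nth)
  next
    case False
    then show ?thesis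
      using that assms(2) by (simp add: successively_conv_nth)
  qed
  then show ?thesis
    by (auto simp: cycle_of_def)
qed

lemma in_set_if_in_edge_cycle_of: "e \<in> edges (cycle_of xs) \<Longrightarrow> v \<in> e \<Longrightarrow> v \<in> set xs"
  by (auto simp: cycle_of_def intro!: nth_mem Suc_mod_less)

lemma ex_two_factor_separating_pair:
  assumes xs: "distinct xs" "3 \<le> length xs" "edges (cycle_of xs) \<subseteq> edges X"
    and ys: "distinct ys" "3 \<le> length ys" "edges (cycle_of ys) \<subseteq> edges X"
    and disj: "set xs \<inter> set ys = {}" and cover: "set xs \<union> set ys = verts X"
    and u: "u \<in> set xs" and v: "v \<in> set ys"
  shows "\<exists>F. two_factor F X \<and> separates F {u, v}"
proof -
  let ?F = "(verts X, edges (cycle_of xs) \<union> edges (cycle_of ys))"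
  let ?C = "{cycle_of xs, cycle_of ys}"
  have verts [simp]: "verts (cycle_of zs) = set zs" for zs :: "'a list"
    by (simp add: cycle_of_def)
  have "valency ?F w = 2" if "w \<in> verts X" for w
  proof -
    \<comment> \<open>By disjointness, only the cycle through \<open>w\<close> contributes edges at
      \<open>w\<close>.\<close>
    have "{e \<in> edges ?F. w \<in> e} = {e \<in> edges (cycle_of (if w \<in> set xs then xs else ys)). w \<in> e}"
      using disj by (auto dest: in_set_if_in_edge_cycle_of)
    moreover have "w \<in> set ys" if "w \<notin> set xs"
      using that \<open>w \<in> verts X\<close> cover by auto
    then have "card {e \<in> edges (cycle_of (if w \<in> set xs then xs else ys)). w \<in> e} = 2"
      using xs ys by (intro valency_cycle_of) simp_all
    ultimately show ?thesis
      by (simp only: valency_def)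
  qed
  then have "two_factor ?F X"
    using xs ys by (simp add: two_factor_def spanning_subgraph_def)
  moreover have "separates ?F {u, v}"
  proof -
    \<comment> \<open>Needed for the count: \<open>{u, v}\<close> and \<open>?C\<close> must both
      have cardinality 2. The two cycles differ because their vertex sets are disjoint and
      nonempty.\<close>
    have ne: "u \<noteq> v" "cycle_of xs \<noteq> cycle_of ys"
      using u v disj verts by (blast, metis disjoint_iff)
    have "consists_of ?F ?C"
      using xs ys disj cover by (auto simp: consists_of_def is_cycle_def)
    moreover have "{u, v} \<inter> set xs = {u}" "{u, v} \<inter> set ys = {v}"
      using u v disj by auto
    ultimately show ?thesis
      using ne by (auto simp: separates_def intro!: exI[of _ ?C])
  qed
  ultimately show ?thesis
    by blast
qed

lemma separates_pair_card_ge_6: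
  assumes "separates F A" "card A = 2" "finite (verts F)"
  shows "6 \<le> card (verts F)"
proof -
  obtain \<C> where \<C>: "consists_of F \<C>" "card \<C> = 2"
    using assms by (auto simp: separates_def)
  then obtain C D where CD: "\<C> = {C, D}" "C \<noteq> D"
    by (auto simp: card_2_iff)
  have cycle: "3 \<le> card (verts B)" if "B \<in> \<C>" for B
    using that \<C> by (auto simp: consists_of_def is_cycle_def cycle_of_def distinct_card)
  have eq: "verts F = verts C \<union> verts D" and disj: "verts C \<inter> verts D = {}"
    using \<C> CD by (auto simp: consists_of_def)
  then have "card (verts F) = card (verts C) + card (verts D)"
    using assms(3) by (simp add: card_Un_disjoint)
  then show ?thesis
    using cycle[of C] cycle[of D] CD by simp
qed

section \<open>Translations of the circulant graph\<close>

text \<open>Adjacency depends only on the difference modulo \<open>n\<close>, hence survives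
  translation by \<open>t\<close>. Here \<open>x\<close> and \<open>y\<close> may be any integers,
  and reduction to representatives happens only after the shift.\<close>

lemma circ_edgeI:
  assumes "n > 0" "c \<in> {1, - 1, s, - s}" "n dvd y - x - c"
  shows "{(x + t) mod n, (y + t) mod n} \<in> edges (circ n s)"
proof -
  have "(y + t) mod n = ((x + t) mod n + c) mod n"
    using assms(3) by (simp add: mod_simps mod_eq_dvd_iff algebra_simps)
  moreover have "(x + t) mod n \<in> {0..<n}"
    using assms(1) by simp
  ultimately show ?thesis
    using assms(2) unfolding circ_def cayley_Zn_def snd_conv mem_Collect_eq
    by (intro exI[of _ "(x + t) mod n"] exI[of _ c]) simp
qed

text \<open>The translation taking \<open>w\<close> to \<open>u\<close> takes
  \<open>w + (v - u)\<close> to \<open>v\<close>. If that point is off the first cycle, it is on the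
  second, so the translated cycles separate \<open>u\<close> from \<open>v\<close>.\<close>

lemma circ_separate_by_translate:
  fixes n s :: int
  defines "R \<equiv> \<lambda>x y. \<exists>c \<in> {1, - 1, s, - s}. n dvd y - x - c"
  assumes xs: "distinct xs" "3 \<le> length xs" "successively R xs" "R (last xs) (hd xs)"
    and ys: "distinct ys" "3 \<le> length ys" "successively R ys" "R (last ys) (hd ys)"
    and disj: "set xs \<inter> set ys = {}" and cover: "set xs \<union> set ys = {0..<n}"
    and w: "w \<in> set xs" "(w + (v - u)) mod n \<notin> set xs"
    and uv: "u \<in> {0..<n}" "v \<in> {0..<n}"
  shows "\<exists>F. two_factor F (circ n s) \<and> separates F {u, v}"
proof -
  define f where "f x = (x + (u - w)) mod n" for x
  have n: "n > 0"
    using uv by simp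
  have inj: "inj_on f {0..<n}"
  proof (rule inj_onI)
    fix x y assume "x \<in> {0..<n}" "y \<in> {0..<n}" "f x = f y"
    then have "n dvd x - y"
      by (simp add: f_def mod_eq_dvd_iff)
    then have "x mod n = y mod n"
      by (simp add: mod_eq_dvd_iff)
    then show "x = y"
      using \<open>x \<in> _\<close> \<open>y \<in> _\<close> by simp
  qed
  have img: "f ` {0..<n} = {0..<n}"
    using inj n by (intro endo_inj_surj) (auto simp: f_def)
  have sub: "set xs \<subseteq> {0..<n}" "set ys \<subseteq> {0..<n}"
    using cover by auto
  have edges: "edges (cycle_of (map f zs)) \<subseteq> edges (circ n s)"
    if "3 \<le> length zs" "successively R zs" "R (last zs) (hd zs)" for zs
  proof (rule edges_cycle_of_subset)
    have R: "{f x, f y} \<in> edges (circ n s)" if "R x y" for x y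
      using that circ_edgeI[OF n] unfolding R_def f_def by blast
    show "map f zs \<noteq> []"
      using that by auto
    then show "{last (map f zs), hd (map f zs)} \<in> edges (circ n s)"
      using that R by (simp add: last_map hd_map)
    show "successively (\<lambda>x y. {x, y} \<in> edges (circ n s)) (map f zs)"
      using that R by (auto simp: successively_map elim: successively_mono)
  qed
  show ?thesis
  proof (rule ex_two_factor_separating_pair[of "map f xs" _ "map f ys"])
    show "distinct (map f xs)" "distinct (map f ys)"
      using xs ys inj sub by (auto simp: distinct_map intro: inj_on_subset)
    show "set (map f xs) \<inter> set (map f ys) = {}"
      using inj_on_image_Int[OF inj sub] disj by simp
    show "set (map f xs) \<union> set (map f ys) = verts (circ n s)"
      using img cover by (simp add: circ_def cayley_Zn_def flip: image_Un)
    show "u \<in> set (map f xs)"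
      using w uv by (auto simp: f_def intro!: image_eqI[of _ _ w])
    have "(w + (v - u)) mod n \<in> set ys"
      using w n cover by (metis UnE atLeastLessThan_iff pos_mod_bound pos_mod_sign)
    moreover have "f ((w + (v - u)) mod n) = v"
      using uv by (simp add: f_def mod_simps)
    ultimately show "v \<in> set (map f ys)"
      by force
  qed (use xs ys edges in auto)
qed

section \<open>The 4-cycle and its complementary cycle\<close>

lemma successively_upto:
  assumes "\<And>i. a \<le> i \<Longrightarrow> i < b \<Longrightarrow> P i (i + 1)"
  shows "successively P [a..b]"
proof -
  have "P (a + int i) (a + int (Suc i))" if "Suc i < nat (b - a + 1)" for i
    using that assms[of "a + int i"] by (simp add: add_ac)
  then show ?thesis
    by (simp add: successively_conv_nth)
qed

lemma hd_upto: "a \<le> b \<Longrightarrow> hd [a..b] = a"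
  by (subst upto_rec1) auto

lemma last_upto: "a \<le> b \<Longrightarrow> last [a..b] = b"
  by (subst upto_rec2) auto

text \<open>If \<open>d\<close> is outside the set, \<open>w = 0\<close> works. Otherwise the
  witnesses reach \<open>s + 2\<close> (for \<open>d = 1\<close> and \<open>d = s + 1\<close>) or
  \<open>2 * s\<close> (for \<open>d = s\<close>), which lie below \<open>n\<close> and outside the
  set.\<close>

lemma ex_translate_leaving:
  fixes n s d :: int
  assumes "2 \<le> s" "2 * s < n" "0 < d" "d < n" "6 \<le> n"
  obtains w where "w \<in> {0, 1, s + 1, s}" "(w + d) mod n \<notin> {0, 1, s + 1, s}"
proof -
  consider "d = 1" | "d = s" | "d = s + 1" | "d \<notin> {0, 1, s + 1, s}"
    using assms by auto
  then show ?thesis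
  proof cases
    case 1
    then show ?thesis using assms that[of "s + 1"] by simp
  next
    case 2
    then show ?thesis using assms that[of s] by simp
  next
    case 3
    then show ?thesis using assms that[of 1] by simp
  next
    case 4
    then show ?thesis using assms that[of 0] by simp
  qed
qed

text \<open>For \<open>s = 2\<close> the interval from 2 to \<open>s - 1\<close> is empty, which is
  why that case needs a different route; there coprimality makes \<open>n\<close> odd.\<close>

lemma ex_complementary_cycle:
  fixes n s :: int
  defines "R \<equiv> \<lambda>x y. \<exists>c \<in> {1, - 1, s, - s}. n dvd y - x - c"
  assumes "2 \<le> s" "2 * s < n" "6 \<le> n" "gcd n s = 1"
  obtains ys where "distinct ys" "3 \<le> length ys" "successively R ys" "R (last ys) (hd ys)"
    "set ys = {0..<n} - {0, 1, s + 1, s}"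
proof (cases "s = 2")
  case True
  then have "odd n"
    using assms(5) by auto
  then obtain h where h: "n = 2 * h + 1"
    by (elim oddE)
  then have "3 \<le> h"
    using assms(4) by simp
  \<comment> \<open>With \<open>n = 2 * h + 1\<close>, these are the even vertices 4, ...,
    \<open>n - 1\<close> upwards and the odd vertices \<open>n - 2\<close>, ..., 5 downwards; both
    are nonempty since \<open>h \<ge> 3\<close>.\<close>
  let ?a = "map (\<lambda>i. 2 * i) [2..h]" and ?b = "map (\<lambda>i. 2 * i + 1) (rev [2..h - 1])"
  have "set (?a @ ?b) = {4..<n}"
  proof (intro equalityI subsetI)
    fix x assume "x \<in> {4..<n}"
    then show "x \<in> set (?a @ ?b)"
      using h by (cases "even x") (auto elim!: evenE oddE)
  qed (use h in auto)
  also have "\<dots> = {0..<n} - {0, 1, s + 1, s}"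
    using True by auto
  finally have set: "set (?a @ ?b) = {0..<n} - {0, 1, s + 1, s}" .
  have ends: "last [2..h] = h" "hd [2..h] = 2" "hd (rev [2..h - 1]) = h - 1"
      "last (rev [2..h - 1]) = 2"
    using \<open>3 \<le> h\<close> by (auto simp: hd_upto last_upto last_rev hd_rev)
  have "successively R ?a" "successively R ?b"
    using True unfolding R_def
    by (auto simp: successively_map successively_rev intro!: successively_upto)
  \<comment> \<open>The two runs are joined at the top and at the bottom by steps of
    \<open>- 1\<close>.\<close>
  moreover have "R (2 * h) (2 * h - 1)" "R 5 4"
    unfolding R_def by (rule bexI[of _ "-1"]; simp)+
  ultimately have "successively R (?a @ ?b)" "R (last (?a @ ?b)) (hd (?a @ ?b))"
    using \<open>3 \<le> h\<close> ends by (auto simp: successively_append_iff last_map hd_map hd_append)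
  moreover have "distinct (?a @ ?b)"
    by (auto simp: distinct_map inj_on_def) presburger
  moreover have "3 \<le> length (?a @ ?b)"
    using \<open>3 \<le> h\<close> by simp
  ultimately show ?thesis
    using that set by blast
next
  case False
  then have "3 \<le> s"
    using assms(2) by simp
  let ?a = "[2..s - 1]" and ?b = "rev [s + 2..n - 1]"
  have set: "set (?a @ ?b) = {0..<n} - {0, 1, s + 1, s}"
    using assms(2,3) by auto
  have ends: "last ?a = s - 1" "hd ?a = 2" "hd ?b = n - 1" "last ?b = s + 2"
    using \<open>3 \<le> s\<close> assms(3) by (auto simp: hd_upto last_upto last_rev hd_rev)
  have "successively R ?a" "successively R ?b"
    unfolding R_def by (auto simp: successively_rev intro!: successively_upto)
  \<comment> \<open>Both joins are steps of \<open>- s\<close>: the first wraps around modulo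
    \<open>n\<close>, the second is an exact difference.\<close>
  moreover have "R (s - 1) (n - 1)" "R (s + 2) 2"
    unfolding R_def by (rule bexI[of _ "- s"]; simp)+
  ultimately have "successively R (?a @ ?b)" "R (last (?a @ ?b)) (hd (?a @ ?b))"
    using \<open>3 \<le> s\<close> assms(3) ends by (auto simp: successively_append_iff hd_append)
  moreover have "distinct (?a @ ?b)"
    by auto
  moreover have "3 \<le> length (?a @ ?b)"
    using \<open>3 \<le> s\<close> assms(3) by simp
  ultimately show ?thesis
    using that set by blast
qed

section \<open>Both directions of the equivalence\<close>

theorem theorem5p1:
  fixes n s :: int
  assumes "s \<ge> 2" and "n \<ge> 2 * s" and "gcd n s = 1"
  shows "spanning_cyclable 2 (circ n s) \<longleftrightarrow> n \<ge> 6"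
proof
  have verts: "verts (circ n s) = {0..<n}"
    by (simp add: circ_def cayley_Zn_def)
  {
    assume "spanning_cyclable 2 (circ n s)"
    \<comment> \<open>Any one pair suffices for the vertex count; 0 and 1 are vertices because
      \<open>n \<ge> 4\<close>.\<close>
    moreover have "{0, 1} \<subseteq> verts (circ n s)" "finite {0, 1 :: int}" "card {0, 1 :: int} = 2"
      using assms(1,2) verts by auto
    ultimately obtain F where F: "two_factor F (circ n s)" "separates F {0, 1}"
      unfolding spanning_cyclable_def by blast
    then have "verts F = {0..<n}"
      by (simp add: two_factor_def spanning_subgraph_def verts)
    then show "n \<ge> 6"
      using separates_pair_card_ge_6[OF F(2)] by simp
  next
    assume n: "n \<ge> 6"
    \<comment> \<open>Otherwise the gcd would be \<open>s\<close>, which is at least 2.\<close>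
    have "n \<noteq> 2 * s"
      using assms(1,3) by auto
    then have sn: "2 * s < n"
      using assms(2) by simp
    show "spanning_cyclable 2 (circ n s)"
      unfolding spanning_cyclable_def
    proof (intro allI impI)
      fix A assume A: "A \<subseteq> verts (circ n s) \<and> finite A \<and> card A = 2"
      then obtain u v where uv: "A = {u, v}" "u \<noteq> v"
        by (auto simp: card_2_iff)
      then have mem: "u \<in> {0..<n}" "v \<in> {0..<n}"
        using A verts by auto
      \<comment> \<open>Distinct representatives differ modulo \<open>n\<close>, so this residue can
        serve as the shift \<open>d\<close> in \<open>ex_translate_leaving\<close>.\<close>
      have "(v - u) mod n \<noteq> 0"
        using uv(2) mem by (metis atLeastLessThan_iff mod_eq_0_iff_dvd
            mod_eq_dvd_iff mod_pos_pos_trivial)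
      moreover have "0 \<le> (v - u) mod n" "(v - u) mod n < n"
        using n by simp_all
      ultimately have "0 < (v - u) mod n" "(v - u) mod n < n"
        by simp_all
      then obtain w where w: "w \<in> {0, 1, s + 1, s}"
        "(w + (v - u) mod n) mod n \<notin> {0, 1, s + 1, s}"
        using ex_translate_leaving[OF assms(1) sn _ _ n] by blast
      let ?R = "\<lambda>x y. \<exists>c \<in> {1, - 1, s, - s}. n dvd y - x - c"
      obtain ys where ys: "distinct ys" "3 \<le> length ys" "successively ?R ys"
        "?R (last ys) (hd ys)" "set ys = {0..<n} - {0, 1, s + 1, s}"
        using ex_complementary_cycle[OF assms(1) sn n assms(3)] by blast
      show "\<exists>F. two_factor F (circ n s) \<and> separates F A"
        unfolding uv(1)
      \<comment> \<open>The 4-cycle takes the steps \<open>1\<close>, \<open>s\<close>,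
        \<open>- 1\<close> and closes with \<open>- s\<close>.\<close>
      proof (rule circ_separate_by_translate[where xs = "[0, 1, s + 1, s]" and ys = ys and w = w])
        show "distinct [0, 1, s + 1, s]"
          using assms(1) by simp
        show "?R (last [0, 1, s + 1, s]) (hd [0, 1, s + 1, s])"
          by simp
        show "set [0, 1, s + 1, s] \<inter> set ys = {}"
          unfolding ys(5) by auto
        show "set [0, 1, s + 1, s] \<union> set ys = {0..<n}"
          unfolding ys(5) using assms(1) sn by auto
        show "w \<in> set [0, 1, s + 1, s]" "(w + (v - u)) mod n \<notin> set [0, 1, s + 1, s]"
          using w by (simp_all only: mod_add_right_eq list.set not_False_eq_True)
        show "successively ?R [0, 1, s + 1, s]"
          by simp
      qed (fact ys mem | simp)+
    qed
  }
qed

end
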